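(* Let $\mathfrak{M}_1$ and $\mathfrak{M}_2$ be image-finite $\mathrm{LE}$-models with underlying polarities $(A_1,X_1,I_1)$ and $(A_2,X_2,I_2)$, and let $a_1\in A_1$, $x_1\in X_1$, $a_2\in A_2$, $x_2\in X_2$. Then: (1) $\mathfrak{M}_1,a_1\rightsquigarrow_A\mathfrak{M}_2,a_2$ if and only if $\mathfrak{M}_1,a_1\rightrightarrows\mathfrak{M}_2,a_2$, i.e. there is a simulation $(S,T)$ from $\mathfrak{M}_1$ to $\mathfrak{M}_2$ with $a_1Sa_2$. (2) $\mathfrak{M}_1,x_1\rightsquigarrow_X\mathfrak{M}_2,x_2$ if and only if $\mathfrak{M}_1,x_1\leftleftarrows\mathfrak{M}_2,x_2$, i.e. there is a simulation $(S,T)$ from $\mathfrak{M}_2$ to $\mathfrak{M}_1$ with $x_2Tx_1$.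
   Context: Language. Fix a countable set $\mathcal{V}$ of propositional variables. The set $\mathcal{L}$ of formulas is given by $\varphi ::= p\mid\bot\mid\top\mid\varphi\wedge\varphi\mid\varphi\vee\varphi\mid\Box\varphi\mid\Diamond\varphi$, $p\in\mathcal{V}$. Polarities. A polarity is $\mathfrak{P}=(A,X,I)$ with $A,X$ sets and $I\subseteq A\times X$. For $B\subseteq A$, $Y\subseteq X$: $B^\uparrow=\{x\in X\mid \forall b\in B,\ bIx\}$, $Y^\downarrow=\{a\in A\mid\forall y\in Y,\ aIy\}$. $B$ (resp. $Y$) is Galois-stable if $B^{\uparrow\downarrow}=B$ (resp. $Y^{\downarrow\uparrow}=Y$). A formal concept is a pair $c=([\![c]\!],(\![c]\!))$ with $[\![c]\!]\subseteq A$, $(\![c]\!)\subseteq X$, $[\![c]\!]^\uparrow=(\![c]\!)$, $(\![c]\!)^\downarrow=[\![c]\!]$. $\mathrm{LE}$-models. An $\mathrm{LE}$-frame is $(A,X,I,R_\Box,R_\Diamond)$ where $(A,X,I)$ is a polarity and $R_\Box\subseteq A\times X$, $R_\Diamond\subseteq X\times A$ are $I$-compatible: for all $a\in A$, $x\in X$, the sets $\{a'\mid a'R_\Box x\}$, $\{x'\mid aR_\Box x'\}$, $\{x'\mid x'R_\Diamond a\}$, $\{a'\mid xR_\Diamond a'\}$ are Galois-stable. An $\mathrm{LE}$-model $\mathfrak{M}$ is an $\mathrm{LE}$-frame with a valuation $V$ assigning to each $p\in\mathcal{V}$ a formal concept $V(p)=([\![V(p)]\!],(\![V(p)]\!))$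 of $(A,X,I)$. Satisfaction (for $a\in A$, $x\in X$): $a\Vdash p$ iff $a\in[\![V(p)]\!]$; $x\succ p$ iff $x\in(\![V(p)]\!)$; $a\Vdash\top$ always; $x\succ\top$ iff $\forall a\in A\, (aIx)$; $x\succ\bot$ always; $a\Vdash\bot$ iff $\forall x\in X\,(aIx)$; $a\Vdash\varphi\wedge\psi$ iff $a\Vdash\varphi$ and $a\Vdash\psi$; $x\succ\varphi\vee\psi$ iff $x\succ\varphi$ and $x\succ\psi$; $a\Vdash\Box\varphi$ iff $\forall x\in X\,(x\succ\varphi\Rightarrow aR_\Box x)$; $x\succ\Diamond\varphi$ iff $\forall a\in A\,(a\Vdash\varphi\Rightarrow xR_\Diamond a)$; for $\chi$ of the form $\varphi\wedge\psi$ or $\Box\varphi$: $x\succ\chi$ iff $\forall a\in A\,(a\Vdash\chi\Rightarrow aIx)$; for $\chi$ of the form $\varphi\vee\psi$ or $\Diamond\varphi$: $a\Vdash\chi$ iff $\forall x\in X\,(x\succ\chi\Rightarrow aIx)$. One writes $\mathfrak{M},a\Vdash\varphi$ and $\mathfrak{M},x\succ\varphi$. Modal comparison. $\mathfrak{M}_1,a_1\rightsquigarrow_A\mathfrak{M}_2,a_2$ means: for all $\varphi\in\mathcal{L}$, $\mathfrak{M}_1,a_1\Vdash\varphi$ implies $\mathfrak{M}_2,a_2\Vdash\varphi$. $\mathfrak{M}_1,x_1\rightsquigarrow_X\mathfrak{M}_2,x_2$ means: for all $\varphi\in\mathcal{L}$, $\mathfrak{M}_1,x_1\succ\varphi$ implies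 $\mathfrak{M}_2,x_2\succ\varphi$. Simulations. Superscript $c$ denotes the complement of a relation. A simulation from $\mathfrak{M}_1=(A_1,X_1,I_1,R_{\Box_1},R_{\Diamond_1},V_1)$ to $\mathfrak{M}_2=(A_2,X_2,I_2,R_{\Box_2},R_{\Diamond_2},V_2)$ is a pair $(S,T)$, $S\subseteq A_1\times A_2$, $T\subseteq X_1\times X_2$, such that for all $a_1,x_1,a_2,x_2$: 1. if $a_1Sa_2$ then for all $p\in\mathcal{V}$, $a_1\in[\![V_1(p)]\!]$ implies $a_2\in[\![V_2(p)]\!]$; 2. if $x_1Tx_2$ then for all $p\in\mathcal{V}$, $x_2\in(\![V_2(p)]\!)$ implies $x_1\in(\![V_1(p)]\!)$; 3. if $a_1Sa_2$ and $a_2I_2^cx_2$, there is $x_1\in X_1$ with $a_1I_1^cx_1$ and $x_1Tx_2$; 4. if $x_1Tx_2$ and $a_1I_1^cx_1$, there is $a_2\in A_2$ with $a_2I_2^cx_2$ and $a_1Sa_2$; 5. if $a_1Sa_2$ and $a_2R_{\Box_2}^cx_2$, there is $x_1\in X_1$ with $a_1R_{\Box_1}^cx_1$ and $x_1Tx_2$; 6. if $x_1Tx_2$ and $x_1R_{\Diamond_1}^ca_1$, there is $a_2\in A_2$ with $x_2R_{\Diamond_2}^ca_2$ and $a_1Sa_2$. Image-finiteness. An $\mathrm{LE}$-model $(A,X,I,R_\Box,R_\Diamond,V)$ is image-finite if for all $a\in A$, $x\in X$ the sets $\{a'\mid a'I^cx\}$, $\{x'\mid aI^cx'\}$, $\{x'\mid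 aR_\Box^cx'\}$, $\{a'\mid xR_\Diamond^ca'\}$ are all finite. *)

theory Defs
  imports Main "HOL-Library.Countable"
begin

datatype 'v formula =
    Var 'v
  | Bot
  | Top
  | Conj "'v formula" "'v formula"
  | Disj "'v formula" "'v formula"
  | Box "'v formula"
  | Dia "'v formula"

record ('a, 'x) polarity =
  objects :: "'a set"
  attributes :: "'x set"
  incidence :: "('a \<times> 'x) set"

definition is_polarity :: "('a, 'x, 'm) polarity_scheme \<Rightarrow> bool" where
  "is_polarity P \<longleftrightarrow> incidence P \<subseteq> objects P \<times> attributes P"

definition up :: "('a, 'x, 'm) polarity_scheme \<Rightarrow> 'a set \<Rightarrow> 'x set" where
  "up P B = {x \<in> attributes P. \<forall>b\<in>B. (b, x) \<in> incidence P}"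

definition down :: "('a, 'x, 'm) polarity_scheme \<Rightarrow> 'x set \<Rightarrow> 'a set" where
  "down P Y = {a \<in> objects P. \<forall>y\<in>Y. (a, y) \<in> incidence P}"

definition stable_objects :: "('a, 'x, 'm) polarity_scheme \<Rightarrow> 'a set \<Rightarrow> bool" where
  "stable_objects P B \<longleftrightarrow> B \<subseteq> objects P \<and> down P (up P B) = B"

definition stable_attributes :: "('a, 'x, 'm) polarity_scheme \<Rightarrow> 'x set \<Rightarrow> bool" where
  "stable_attributes P Y \<longleftrightarrow> Y \<subseteq> attributes P \<and> up P (down P Y) = Y"

definition formal_concept :: "('a, 'x, 'm) polarity_scheme \<Rightarrow> 'a set \<times> 'x set \<Rightarrow> bool" where
  "formal_concept P c \<longleftrightarrow>
     fst c \<subseteq> objects P \<and> snd c \<subseteq> attributes P \<and>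
     up P (fst c) = snd c \<and> down P (snd c) = fst c"

record ('a, 'x) le_frame = "('a, 'x) polarity" +
  Rbox :: "('a \<times> 'x) set"
  Rdia :: "('x \<times> 'a) set"

definition is_le_frame :: "('a, 'x, 'm) le_frame_scheme \<Rightarrow> bool" where
  "is_le_frame F \<longleftrightarrow>
     is_polarity F \<and>
     Rbox F \<subseteq> objects F \<times> attributes F \<and>
     Rdia F \<subseteq> attributes F \<times> objects F \<and>
     (\<forall>x\<in>attributes F. stable_objects F {a' \<in> objects F. (a', x) \<in> Rbox F}) \<and>
     (\<forall>a\<in>objects F. stable_attributes F {x' \<in> attributes F. (a, x') \<in> Rbox F}) \<and>
     (\<forall>a\<in>objects F. stable_attributes F {x' \<in> attributes F. (x', a) \<in> Rdia F}) \<and>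
     (\<forall>x\<in>attributes F. stable_objects F {a' \<in> objects F. (x, a') \<in> Rdia F})"

record ('a, 'x, 'v) le_model = "('a, 'x) le_frame" +
  val :: "'v \<Rightarrow> 'a set \<times> 'x set"

definition is_le_model :: "('a, 'x, 'v) le_model \<Rightarrow> bool" where
  "is_le_model M \<longleftrightarrow> is_le_frame M \<and> (\<forall>p. formal_concept M (val M p))"

text \<open>
  Satisfaction \<open>sat M a \<phi>\<close> (a forces \<open>\<phi>\<close>) and co-satisfaction \<open>cosat M x \<phi>\<close> (x refutes \<open>\<phi>\<close>).
  They are meaningful only for \<open>a\<close> in \<open>objects M\<close> and \<open>x\<close> in \<open>attributes M\<close>; all quantifiers
  range over these carriers.  For conjunctions and boxes co-satisfaction refers to satisfaction
  of the same formula, for disjunctions and diamonds it is the other way round, so the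
  termination measure charges one extra unit for that step.
\<close>

function sat :: "('a, 'x, 'v) le_model \<Rightarrow> 'a \<Rightarrow> 'v formula \<Rightarrow> bool"
  and cosat :: "('a, 'x, 'v) le_model \<Rightarrow> 'x \<Rightarrow> 'v formula \<Rightarrow> bool" where
  "sat M a (Var p) \<longleftrightarrow> a \<in> fst (val M p)"
| "sat M a Bot \<longleftrightarrow> (\<forall>x\<in>attributes M. (a, x) \<in> incidence M)"
| "sat M a Top \<longleftrightarrow> True"
| "sat M a (Conj \<phi> \<psi>) \<longleftrightarrow> sat M a \<phi> \<and> sat M a \<psi>"
| "sat M a (Disj \<phi> \<psi>) \<longleftrightarrow>
     (\<forall>x\<in>attributes M. cosat M x (Disj \<phi> \<psi>) \<longrightarrow> (a, x) \<in> incidence M)"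
| "sat M a (Box \<phi>) \<longleftrightarrow> (\<forall>x\<in>attributes M. cosat M x \<phi> \<longrightarrow> (a, x) \<in> Rbox M)"
| "sat M a (Dia \<phi>) \<longleftrightarrow>
     (\<forall>x\<in>attributes M. cosat M x (Dia \<phi>) \<longrightarrow> (a, x) \<in> incidence M)"
| "cosat M x (Var p) \<longleftrightarrow> x \<in> snd (val M p)"
| "cosat M x Bot \<longleftrightarrow> True"
| "cosat M x Top \<longleftrightarrow> (\<forall>a\<in>objects M. (a, x) \<in> incidence M)"
| "cosat M x (Conj \<phi> \<psi>) \<longleftrightarrow>
     (\<forall>a\<in>objects M. sat M a (Conj \<phi> \<psi>) \<longrightarrow> (a, x) \<in> incidence M)"
| "cosat M x (Disj \<phi> \<psi>) \<longleftrightarrow> cosat M x \<phi> \<and> cosat M x \<psi>"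
| "cosat M x (Box \<phi>) \<longleftrightarrow>
     (\<forall>a\<in>objects M. sat M a (Box \<phi>) \<longrightarrow> (a, x) \<in> incidence M)"
| "cosat M x (Dia \<phi>) \<longleftrightarrow> (\<forall>a\<in>objects M. sat M a \<phi> \<longrightarrow> (x, a) \<in> Rdia M)"
  by pat_completeness auto
termination
  by (relation "measure (case_sum
        (\<lambda>(M, a, \<phi>). 2 * size \<phi> + (case \<phi> of Disj _ _ \<Rightarrow> 1 | Dia _ \<Rightarrow> 1 | _ \<Rightarrow> 0))
        (\<lambda>(M, x, \<phi>). 2 * size \<phi> + (case \<phi> of Conj _ _ \<Rightarrow> 1 | Box _ \<Rightarrow> 1 | _ \<Rightarrow> 0)))")
    (auto split: formula.split)

definition modal_le_A ::
  "('a1, 'x1, 'v) le_model \<Rightarrow> 'a1 \<Rightarrow> ('a2, 'x2, 'v) le_model \<Rightarrow> 'a2 \<Rightarrow> bool" where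
  "modal_le_A M1 a1 M2 a2 \<longleftrightarrow> (\<forall>\<phi>. sat M1 a1 \<phi> \<longrightarrow> sat M2 a2 \<phi>)"

definition modal_le_X ::
  "('a1, 'x1, 'v) le_model \<Rightarrow> 'x1 \<Rightarrow> ('a2, 'x2, 'v) le_model \<Rightarrow> 'x2 \<Rightarrow> bool" where
  "modal_le_X M1 x1 M2 x2 \<longleftrightarrow> (\<forall>\<phi>. cosat M1 x1 \<phi> \<longrightarrow> cosat M2 x2 \<phi>)"

definition simulation ::
  "('a1, 'x1, 'v) le_model \<Rightarrow> ('a2, 'x2, 'v) le_model \<Rightarrow>
   ('a1 \<times> 'a2) set \<Rightarrow> ('x1 \<times> 'x2) set \<Rightarrow> bool" where
  "simulation M1 M2 S T \<longleftrightarrow>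
     S \<subseteq> objects M1 \<times> objects M2 \<and>
     T \<subseteq> attributes M1 \<times> attributes M2 \<and>
     (\<forall>a1 a2. (a1, a2) \<in> S \<longrightarrow> (\<forall>p. a1 \<in> fst (val M1 p) \<longrightarrow> a2 \<in> fst (val M2 p))) \<and>
     (\<forall>x1 x2. (x1, x2) \<in> T \<longrightarrow> (\<forall>p. x2 \<in> snd (val M2 p) \<longrightarrow> x1 \<in> snd (val M1 p))) \<and>
     (\<forall>a1 a2. \<forall>x2\<in>attributes M2. (a1, a2) \<in> S \<and> (a2, x2) \<notin> incidence M2 \<longrightarrow>
        (\<exists>x1\<in>attributes M1. (a1, x1) \<notin> incidence M1 \<and> (x1, x2) \<in> T)) \<and>
     (\<forall>x1 x2. \<forall>a1\<in>objects M1. (x1, x2) \<in> T \<and> (a1, x1) \<notin> incidence M1 \<longrightarrow>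
        (\<exists>a2\<in>objects M2. (a2, x2) \<notin> incidence M2 \<and> (a1, a2) \<in> S)) \<and>
     (\<forall>a1 a2. \<forall>x2\<in>attributes M2. (a1, a2) \<in> S \<and> (a2, x2) \<notin> Rbox M2 \<longrightarrow>
        (\<exists>x1\<in>attributes M1. (a1, x1) \<notin> Rbox M1 \<and> (x1, x2) \<in> T)) \<and>
     (\<forall>x1 x2. \<forall>a1\<in>objects M1. (x1, x2) \<in> T \<and> (x1, a1) \<notin> Rdia M1 \<longrightarrow>
        (\<exists>a2\<in>objects M2. (x2, a2) \<notin> Rdia M2 \<and> (a1, a2) \<in> S))"

definition simulated_A ::
  "('a1, 'x1, 'v) le_model \<Rightarrow> 'a1 \<Rightarrow> ('a2, 'x2, 'v) le_model \<Rightarrow> 'a2 \<Rightarrow> bool" where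
  "simulated_A M1 a1 M2 a2 \<longleftrightarrow> (\<exists>S T. simulation M1 M2 S T \<and> (a1, a2) \<in> S)"

text \<open>On attributes the simulation runs in the opposite direction, from \<open>M2\<close> to \<open>M1\<close>.\<close>

definition simulated_X ::
  "('a1, 'x1, 'v) le_model \<Rightarrow> 'x1 \<Rightarrow> ('a2, 'x2, 'v) le_model \<Rightarrow> 'x2 \<Rightarrow> bool" where
  "simulated_X M1 x1 M2 x2 \<longleftrightarrow> (\<exists>S T. simulation M2 M1 S T \<and> (x2, x1) \<in> T)"

definition image_finite :: "('a, 'x, 'v) le_model \<Rightarrow> bool" where
  "image_finite M \<longleftrightarrow>
     (\<forall>x\<in>attributes M. finite {a' \<in> objects M. (a', x) \<notin> incidence M}) \<and>
     (\<forall>a\<in>objects M. finite {x' \<in> attributes M. (a, x') \<notin> incidence M}) \<and>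
     (\<forall>a\<in>objects M. finite {x' \<in> attributes M. (a, x') \<notin> Rbox M}) \<and>
     (\<forall>x\<in>attributes M. finite {a' \<in> objects M. (x, a') \<notin> Rdia M})"

end

theory Submission
  imports Defs
begin

text \<open>
  This is a Hennessy--Milner theorem for a two-sorted semantics, and both directions rest on one
  fact: the satisfaction set and the co-satisfaction set of a formula determine each other through
  the incidence relation (\<open>sat_iff_cosat\<close>, \<open>cosat_iff_sat\<close>), so every formula denotes a formal
  concept.  For boxes and diamonds this is where compatibility of the modal relations enters.

  A simulation preserves satisfaction forwards along \<open>S\<close> and co-satisfaction backwards along \<open>T\<close>.
  The two back-and-forth clauses for non-incidence convert each of these two statements about a
  fixed formula into the other, because failing to satisfy a formula means being non-incident with
  a co-satisfier, and dually.  In the induction on formulas it therefore suffices to treat each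
  connective on the side where its semantic clause is recursive (\<open>simulation_preserves\<close>).

  Conversely, on image-finite models the modal comparison relations themselves form a simulation
  (\<open>modal_comparison_simulation\<close>).  If a clause had no witness, each of the finitely many candidates
  would be excluded by a formula.  On the attribute side these formulas are combined
  by disjunction, because an attribute co-satisfies a disjunction iff it co-satisfies both disjuncts;
  on the object side they are combined by conjunction.  The resulting formula, prefixed by
  \<open>Box\<close> or \<open>Dia\<close> in the modal clauses, contradicts the comparison one started from.

  The claim about attributes is the claim about objects with the two models exchanged, since \<open>T\<close>
  is traversed backwards.
\<close>

section \<open>Formulas denote formal concepts\<close>

text \<open>
  Galois-stability is used through these membership tests, applied to sections of \<open>Rbox\<close>
  and \<open>Rdia\<close>.
\<close>

lemma stable_objects_memI:
  assumes "stable_objects P B" and "a \<in> objects P"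
    and "\<And>x. x \<in> attributes P \<Longrightarrow> (\<And>b. b \<in> B \<Longrightarrow> (b, x) \<in> incidence P) \<Longrightarrow> (a, x) \<in> incidence P"
  shows "a \<in> B"
proof -
  have "a \<in> down P (up P B)"
    using assms(2,3) by (auto simp: up_def down_def)
  then show ?thesis
    using assms(1) by (simp add: stable_objects_def)
qed

lemma stable_attributes_memI:
  assumes "stable_attributes P Y" and "x \<in> attributes P"
    and "\<And>a. a \<in> objects P \<Longrightarrow> (\<And>y. y \<in> Y \<Longrightarrow> (a, y) \<in> incidence P) \<Longrightarrow> (a, x) \<in> incidence P"
  shows "x \<in> Y"
proof -
  have "x \<in> up P (down P Y)"
    using assms(2,3) by (auto simp: up_def down_def)
  then show ?thesis
    using assms(1) by (simp add: stable_attributes_def)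
qed

text \<open>
  For every connective one of the two equivalences is the semantic clause itself.  The other one
  says that the set given by the recursive clause is Galois-stable: for conjunctions and
  disjunctions it is an intersection of sets stable by induction, for boxes and diamonds an
  intersection of sections of a compatible relation.
\<close>

lemma sat_cosat_galois:
  assumes "is_le_model M"
  shows "(\<forall>a\<in>objects M. sat M a \<phi> \<longleftrightarrow>
            (\<forall>x\<in>attributes M. cosat M x \<phi> \<longrightarrow> (a, x) \<in> incidence M)) \<and>
         (\<forall>x\<in>attributes M. cosat M x \<phi> \<longleftrightarrow>
            (\<forall>a\<in>objects M. sat M a \<phi> \<longrightarrow> (a, x) \<in> incidence M))"
proof (induction \<phi>)
  case (Var p)
  have "formal_concept M (val M p)"
    using assms by (simp add: is_le_model_def)
  then have c: "fst (val M p) \<subseteq> objects M" "snd (val M p) \<subseteq> attributes M"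
    "up M (fst (val M p)) = snd (val M p)" "down M (snd (val M p)) = fst (val M p)"
    by (simp_all add: formal_concept_def)
  have "a \<in> fst (val M p) \<longleftrightarrow> (\<forall>x\<in>attributes M. x \<in> snd (val M p) \<longrightarrow> (a, x) \<in> incidence M)"
    if "a \<in> objects M" for a
    using that c(2) by (subst c(4)[symmetric]) (auto simp: down_def)
  moreover have "x \<in> snd (val M p) \<longleftrightarrow>
      (\<forall>a\<in>objects M. a \<in> fst (val M p) \<longrightarrow> (a, x) \<in> incidence M)"
    if "x \<in> attributes M" for x
    using that c(1) by (subst c(3)[symmetric]) (auto simp: up_def)
  ultimately show ?case
    unfolding sat.simps(1) cosat.simps(1) by blast
next
  case Bot
  then show ?case by simp
next
  case Top
  then show ?case by simp
next
  case (Conj \<phi> \<psi>)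
  have "sat M a (Conj \<phi> \<psi>)"
    if a: "a \<in> objects M"
      and h: "\<forall>x\<in>attributes M. cosat M x (Conj \<phi> \<psi>) \<longrightarrow> (a, x) \<in> incidence M" for a
  proof -
    have "cosat M x (Conj \<phi> \<psi>)" if "x \<in> attributes M" "cosat M x \<phi> \<or> cosat M x \<psi>" for x
      using Conj.IH that unfolding cosat.simps(4) sat.simps(4) by blast
    with h have "\<forall>x\<in>attributes M. cosat M x \<phi> \<longrightarrow> (a, x) \<in> incidence M"
      and "\<forall>x\<in>attributes M. cosat M x \<psi> \<longrightarrow> (a, x) \<in> incidence M" by blast+
    with Conj.IH a show ?thesis
      unfolding sat.simps(4) by blast
  qed
  then show ?case
    using cosat.simps(4)[of M _ \<phi> \<psi>] by blast
next
  case (Disj \<phi> \<psi>)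
  have "cosat M x (Disj \<phi> \<psi>)"
    if x: "x \<in> attributes M"
      and h: "\<forall>a\<in>objects M. sat M a (Disj \<phi> \<psi>) \<longrightarrow> (a, x) \<in> incidence M" for x
  proof -
    have "sat M a (Disj \<phi> \<psi>)" if "a \<in> objects M" "sat M a \<phi> \<or> sat M a \<psi>" for a
      using Disj.IH that unfolding sat.simps(5) cosat.simps(5) by blast
    with h have "\<forall>a\<in>objects M. sat M a \<phi> \<longrightarrow> (a, x) \<in> incidence M"
      and "\<forall>a\<in>objects M. sat M a \<psi> \<longrightarrow> (a, x) \<in> incidence M" by blast+
    with Disj.IH x show ?thesis
      unfolding cosat.simps(5) by blast
  qed
  then show ?case
    using sat.simps(5)[of M _ \<phi> \<psi>] by blast
next
  case (Box \<phi>)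
  have "(a, y) \<in> Rbox M"
    if a: "a \<in> objects M"
      and h: "\<forall>x\<in>attributes M. cosat M x (Box \<phi>) \<longrightarrow> (a, x) \<in> incidence M"
      and y: "y \<in> attributes M" "cosat M y \<phi>" for a y
  proof -
    have st: "stable_objects M {a' \<in> objects M. (a', y) \<in> Rbox M}"
      using assms y(1) by (simp add: is_le_model_def is_le_frame_def)
    have "a \<in> {a' \<in> objects M. (a', y) \<in> Rbox M}"
      using y h by (intro stable_objects_memI[OF st a]) auto
    then show ?thesis by simp
  qed
  then have "sat M a (Box \<phi>)"
    if "a \<in> objects M"
      and "\<forall>x\<in>attributes M. cosat M x (Box \<phi>) \<longrightarrow> (a, x) \<in> incidence M" for a
    using that unfolding sat.simps(6) by blast
  then show ?case
    using cosat.simps(6)[of M _ \<phi>] by blast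
next
  case (Dia \<phi>)
  have "(x, b) \<in> Rdia M"
    if x: "x \<in> attributes M"
      and h: "\<forall>a\<in>objects M. sat M a (Dia \<phi>) \<longrightarrow> (a, x) \<in> incidence M"
      and b: "b \<in> objects M" "sat M b \<phi>" for x b
  proof -
    have st: "stable_attributes M {x' \<in> attributes M. (x', b) \<in> Rdia M}"
      using assms b(1) by (simp add: is_le_model_def is_le_frame_def)
    have "x \<in> {x' \<in> attributes M. (x', b) \<in> Rdia M}"
      using b h by (intro stable_attributes_memI[OF st x]) auto
    then show ?thesis by simp
  qed
  then have "cosat M x (Dia \<phi>)"
    if "x \<in> attributes M"
      and "\<forall>a\<in>objects M. sat M a (Dia \<phi>) \<longrightarrow> (a, x) \<in> incidence M" for x
    using that unfolding cosat.simps(7) by blast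
  then show ?case
    using sat.simps(7)[of M _ \<phi>] by blast
qed

lemma sat_iff_cosat:
  assumes "is_le_model M" and "a \<in> objects M"
  shows "sat M a \<phi> \<longleftrightarrow> (\<forall>x\<in>attributes M. cosat M x \<phi> \<longrightarrow> (a, x) \<in> incidence M)"
  using sat_cosat_galois[OF assms(1), of \<phi>] assms(2) by blast

lemma cosat_iff_sat:
  assumes "is_le_model M" and "x \<in> attributes M"
  shows "cosat M x \<phi> \<longleftrightarrow> (\<forall>a\<in>objects M. sat M a \<phi> \<longrightarrow> (a, x) \<in> incidence M)"
  using sat_cosat_galois[OF assms(1), of \<phi>] assms(2) by blast

section \<open>Simulations preserve formulas\<close>

lemma simulationD:
  assumes "simulation M1 M2 S T"
  shows simulation_S_carrier: "\<And>a1 a2. (a1, a2) \<in> S \<Longrightarrow> a1 \<in> objects M1 \<and> a2 \<in> objects M2"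
    and simulation_T_carrier: "\<And>x1 x2. (x1, x2) \<in> T \<Longrightarrow> x1 \<in> attributes M1 \<and> x2 \<in> attributes M2"
    and simulation_S_val:
      "\<And>a1 a2 p. (a1, a2) \<in> S \<Longrightarrow> a1 \<in> fst (val M1 p) \<Longrightarrow> a2 \<in> fst (val M2 p)"
    and simulation_T_val:
      "\<And>x1 x2 p. (x1, x2) \<in> T \<Longrightarrow> x2 \<in> snd (val M2 p) \<Longrightarrow> x1 \<in> snd (val M1 p)"
    and simulation_S_incidence:
      "\<And>a1 a2 x2. (a1, a2) \<in> S \<Longrightarrow> x2 \<in> attributes M2 \<Longrightarrow> (a2, x2) \<notin> incidence M2 \<Longrightarrow>
         \<exists>x1\<in>attributes M1. (a1, x1) \<notin> incidence M1 \<and> (x1, x2) \<in> T"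
    and simulation_T_incidence:
      "\<And>x1 x2 a1. (x1, x2) \<in> T \<Longrightarrow> a1 \<in> objects M1 \<Longrightarrow> (a1, x1) \<notin> incidence M1 \<Longrightarrow>
         \<exists>a2\<in>objects M2. (a2, x2) \<notin> incidence M2 \<and> (a1, a2) \<in> S"
    and simulation_S_Rbox:
      "\<And>a1 a2 x2. (a1, a2) \<in> S \<Longrightarrow> x2 \<in> attributes M2 \<Longrightarrow> (a2, x2) \<notin> Rbox M2 \<Longrightarrow>
         \<exists>x1\<in>attributes M1. (a1, x1) \<notin> Rbox M1 \<and> (x1, x2) \<in> T"
    and simulation_T_Rdia:
      "\<And>x1 x2 a1. (x1, x2) \<in> T \<Longrightarrow> a1 \<in> objects M1 \<Longrightarrow> (x1, a1) \<notin> Rdia M1 \<Longrightarrow>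
         \<exists>a2\<in>objects M2. (x2, a2) \<notin> Rdia M2 \<and> (a1, a2) \<in> S"
  using assms unfolding simulation_def by blast+

text \<open>
  If \<open>a2\<close> does not satisfy \<open>\<phi>\<close>, it is non-incident with some co-satisfier \<open>x2\<close> of \<open>\<phi>\<close>;
  the simulation pulls \<open>x2\<close> back to a co-satisfier that is non-incident with \<open>a1\<close>.
\<close>

lemma simulation_sat_if_cosat:
  assumes "is_le_model M1" and "is_le_model M2" and "simulation M1 M2 S T"
    and "\<And>x1 x2. (x1, x2) \<in> T \<Longrightarrow> cosat M2 x2 \<phi> \<Longrightarrow> cosat M1 x1 \<phi>"
    and "(a1, a2) \<in> S" and "sat M1 a1 \<phi>"
  shows "sat M2 a2 \<phi>"
  using simulation_S_carrier[OF assms(3,5)] simulation_S_incidence[OF assms(3,5)] assms(4,6)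
  by (metis sat_iff_cosat[OF assms(1)] sat_iff_cosat[OF assms(2)])

lemma simulation_cosat_if_sat:
  assumes "is_le_model M1" and "is_le_model M2" and "simulation M1 M2 S T"
    and "\<And>a1 a2. (a1, a2) \<in> S \<Longrightarrow> sat M1 a1 \<phi> \<Longrightarrow> sat M2 a2 \<phi>"
    and "(x1, x2) \<in> T" and "cosat M2 x2 \<phi>"
  shows "cosat M1 x1 \<phi>"
  using simulation_T_carrier[OF assms(3,5)] simulation_T_incidence[OF assms(3,5)] assms(4,6)
  by (metis cosat_iff_sat[OF assms(1)] cosat_iff_sat[OF assms(2)])

lemma simulation_preserves:
  assumes M: "is_le_model M1" "is_le_model M2" and sim: "simulation M1 M2 S T"
  shows "(\<forall>a1 a2. (a1, a2) \<in> S \<longrightarrow> sat M1 a1 \<phi> \<longrightarrow> sat M2 a2 \<phi>) \<and>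
         (\<forall>x1 x2. (x1, x2) \<in> T \<longrightarrow> cosat M2 x2 \<phi> \<longrightarrow> cosat M1 x1 \<phi>)"
    (is "?A \<phi> \<and> ?X \<phi>")
proof -
  have X_if_A: "?X \<phi>" if "?A \<phi>" for \<phi>
    using simulation_cosat_if_sat[OF M sim] that by blast
  have A_if_X: "?A \<phi>" if "?X \<phi>" for \<phi>
    using simulation_sat_if_cosat[OF M sim] that by blast
  show ?thesis
  proof (induction \<phi>)
    case (Var p)
    then show ?case
      using simulation_S_val[OF sim] simulation_T_val[OF sim] by auto
  next
    case Bot
    have "?X Bot" by simp
    with A_if_X show ?case by blast
  next
    case Top
    have "?A Top" by simp
    with X_if_A show ?case by blast
  next
    case (Conj \<phi> \<psi>)
    then have "?A (Conj \<phi> \<psi>)" by simp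
    with X_if_A show ?case by blast
  next
    case (Disj \<phi> \<psi>)
    then have "?X (Disj \<phi> \<psi>)" by simp
    with A_if_X show ?case by blast
  next
    case (Box \<phi>)
    then have "?A (Box \<phi>)"
      using simulation_S_Rbox[OF sim] by (metis sat.simps(6))
    with X_if_A show ?case by blast
  next
    case (Dia \<phi>)
    then have "?X (Dia \<phi>)"
      using simulation_T_Rdia[OF sim] by (metis cosat.simps(7))
    with A_if_X show ?case by blast
  qed
qed

section \<open>The simulation given by modal comparison\<close>

text \<open>
  Finitely many separating formulas are merged by disjunction, which co-satisfaction treats
  conjunctively; \<open>Bot\<close>, co-satisfied by every attribute, is the empty case.
\<close>

lemma finite_attributes_separation:
  assumes "finite Y" and "\<And>y. y \<in> Y \<Longrightarrow> \<not> modal_le_X N z M y"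
  shows "\<exists>\<psi>. cosat N z \<psi> \<and> (\<forall>y\<in>Y. \<not> cosat M y \<psi>)"
  using assms
proof (induction Y)
  case empty
  have "cosat N z Bot" by simp
  then show ?case by blast
next
  case (insert y Y)
  then obtain \<psi> where \<psi>: "cosat N z \<psi>" "\<forall>y\<in>Y. \<not> cosat M y \<psi>" by auto
  obtain \<chi> where "cosat N z \<chi>" "\<not> cosat M y \<chi>"
    using insert.prems[of y] by (auto simp: modal_le_X_def)
  with \<psi> have "cosat N z (Disj \<chi> \<psi>) \<and> (\<forall>y\<in>insert y Y. \<not> cosat M y (Disj \<chi> \<psi>))" by simp
  then show ?case by blast
qed

lemma finite_objects_separation:
  assumes "finite B" and "\<And>b. b \<in> B \<Longrightarrow> \<not> modal_le_A M c N b"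
  shows "\<exists>\<psi>. sat M c \<psi> \<and> (\<forall>b\<in>B. \<not> sat N b \<psi>)"
  using assms
proof (induction B)
  case empty
  have "sat M c Top" by simp
  then show ?case by blast
next
  case (insert b B)
  then obtain \<psi> where \<psi>: "sat M c \<psi>" "\<forall>b\<in>B. \<not> sat N b \<psi>" by auto
  obtain \<chi> where "sat M c \<chi>" "\<not> sat N b \<chi>"
    using insert.prems[of b] by (auto simp: modal_le_A_def)
  with \<psi> have "sat M c (Conj \<chi> \<psi>) \<and> (\<forall>b\<in>insert b B. \<not> sat N b (Conj \<chi> \<psi>))" by simp
  then show ?case by blast
qed

text \<open>
  The non-incidence clause and the clause for the modal relation have the same shape, so both are
  covered at once: \<open>Q\<close> and \<open>Q'\<close> are the interpretations of the relation in the two models, and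
  \<open>f\<close> is the operation on formulas that the relation governs, namely the identity for incidence
  and \<open>Box\<close> or \<open>Dia\<close> for the modal relation.
\<close>

lemma modal_le_A_back:
  assumes le: "modal_le_A M1 a1 M2 a2"
    and f1: "\<And>\<psi>. sat M1 a1 (f \<psi>) \<longleftrightarrow> (\<forall>x\<in>attributes M1. cosat M1 x \<psi> \<longrightarrow> (a1, x) \<in> Q)"
    and f2: "\<And>\<psi>. sat M2 a2 (f \<psi>) \<longleftrightarrow> (\<forall>x\<in>attributes M2. cosat M2 x \<psi> \<longrightarrow> (a2, x) \<in> Q')"
    and fin: "finite {x \<in> attributes M1. (a1, x) \<notin> Q}"
    and x2: "x2 \<in> attributes M2" "(a2, x2) \<notin> Q'"
  shows "\<exists>x1\<in>attributes M1. (a1, x1) \<notin> Q \<and> modal_le_X M2 x2 M1 x1"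
proof (rule ccontr)
  assume "\<not> ?thesis"
  then obtain \<psi> where \<psi>: "cosat M2 x2 \<psi>"
    "\<forall>x\<in>{x \<in> attributes M1. (a1, x) \<notin> Q}. \<not> cosat M1 x \<psi>"
    using finite_attributes_separation[OF fin, of M2 x2 M1] by blast
  then have "sat M1 a1 (f \<psi>)"
    unfolding f1 by blast
  with le have "sat M2 a2 (f \<psi>)"
    by (simp add: modal_le_A_def)
  with \<psi>(1) x2 show False
    unfolding f2 by blast
qed

lemma modal_le_X_forth:
  assumes le: "modal_le_X M2 x2 M1 x1"
    and f1: "\<And>\<psi>. cosat M1 x1 (f \<psi>) \<longleftrightarrow> (\<forall>a\<in>objects M1. sat M1 a \<psi> \<longrightarrow> (x1, a) \<in> Q)"
    and f2: "\<And>\<psi>. cosat M2 x2 (f \<psi>) \<longleftrightarrow> (\<forall>a\<in>objects M2. sat M2 a \<psi> \<longrightarrow> (x2, a) \<in> Q')"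
    and fin: "finite {a \<in> objects M2. (x2, a) \<notin> Q'}"
    and a1: "a1 \<in> objects M1" "(x1, a1) \<notin> Q"
  shows "\<exists>a2\<in>objects M2. (x2, a2) \<notin> Q' \<and> modal_le_A M1 a1 M2 a2"
proof (rule ccontr)
  assume "\<not> ?thesis"
  then obtain \<psi> where \<psi>: "sat M1 a1 \<psi>"
    "\<forall>a\<in>{a \<in> objects M2. (x2, a) \<notin> Q'}. \<not> sat M2 a \<psi>"
    using finite_objects_separation[OF fin, of M1 a1 M2] by blast
  then have "cosat M2 x2 (f \<psi>)"
    unfolding f2 by blast
  with le have "cosat M1 x1 (f \<psi>)"
    by (simp add: modal_le_X_def)
  with \<psi>(1) a1 show False
    unfolding f1 by blast
qed

lemma modal_comparison_simulation:
  assumes M: "is_le_model M1" "is_le_model M2"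
    and fin: "image_finite M1" "image_finite M2"
  defines "S \<equiv> {(a1, a2). a1 \<in> objects M1 \<and> a2 \<in> objects M2 \<and> modal_le_A M1 a1 M2 a2}"
    and "T \<equiv> {(x1, x2). x1 \<in> attributes M1 \<and> x2 \<in> attributes M2 \<and> modal_le_X M2 x2 M1 x1}"
  shows "simulation M1 M2 S T"
  unfolding simulation_def
proof (intro conjI allI ballI impI; (elim conjE)?)
  show "S \<subseteq> objects M1 \<times> objects M2" "T \<subseteq> attributes M1 \<times> attributes M2"
    by (auto simp: S_def T_def)
next
  fix a1 a2 p
  assume "(a1, a2) \<in> S" and "a1 \<in> fst (val M1 p)"
  then have "modal_le_A M1 a1 M2 a2" and "sat M1 a1 (Var p)" by (simp_all add: S_def)
  then have "sat M2 a2 (Var p)" unfolding modal_le_A_def by blast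
  then show "a2 \<in> fst (val M2 p)" by simp
next
  fix x1 x2 p
  assume "(x1, x2) \<in> T" and "x2 \<in> snd (val M2 p)"
  then have "modal_le_X M2 x2 M1 x1" and "cosat M2 x2 (Var p)" by (simp_all add: T_def)
  then have "cosat M1 x1 (Var p)" unfolding modal_le_X_def by blast
  then show "x1 \<in> snd (val M1 p)" by simp
next
  fix a1 a2 x2
  assume x2: "x2 \<in> attributes M2" "(a2, x2) \<notin> incidence M2" and "(a1, a2) \<in> S"
  then have a: "a1 \<in> objects M1" "a2 \<in> objects M2" "modal_le_A M1 a1 M2 a2"
    by (auto simp: S_def)
  have "finite {x \<in> attributes M1. (a1, x) \<notin> incidence M1}"
    using fin(1) a(1) by (simp add: image_finite_def)
  with modal_le_A_back[where f = "\<lambda>\<psi>. \<psi>", OF a(3) sat_iff_cosat[OF M(1) a(1)]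
      sat_iff_cosat[OF M(2) a(2)] _ x2] x2(1)
  show "\<exists>x1\<in>attributes M1. (a1, x1) \<notin> incidence M1 \<and> (x1, x2) \<in> T"
    by (auto simp: T_def)
next
  fix x1 x2 a1
  assume a1: "a1 \<in> objects M1" "(a1, x1) \<notin> incidence M1" and "(x1, x2) \<in> T"
  then have x: "x1 \<in> attributes M1" "x2 \<in> attributes M2" "modal_le_X M2 x2 M1 x1"
    by (auto simp: T_def)
  have "finite {a \<in> objects M2. (a, x2) \<notin> incidence M2}"
    using fin(2) x(2) by (simp add: image_finite_def)
  \<comment> \<open>The forth lemma has the attribute first, as in \<open>Rdia\<close>; hence the converse of incidence.\<close>
  with modal_le_X_forth[where f = "\<lambda>\<psi>. \<psi>" and Q = "(incidence M1)\<inverse>" and Q' = "(incidence M2)\<inverse>",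
      OF x(3), of a1] a1 cosat_iff_sat[OF M(1) x(1)] cosat_iff_sat[OF M(2) x(2)]
  show "\<exists>a2\<in>objects M2. (a2, x2) \<notin> incidence M2 \<and> (a1, a2) \<in> S"
    by (auto simp: S_def)
next
  fix a1 a2 x2
  assume x2: "x2 \<in> attributes M2" "(a2, x2) \<notin> Rbox M2" and "(a1, a2) \<in> S"
  then have a: "a1 \<in> objects M1" "a2 \<in> objects M2" "modal_le_A M1 a1 M2 a2"
    by (auto simp: S_def)
  have "finite {x \<in> attributes M1. (a1, x) \<notin> Rbox M1}"
    using fin(1) a(1) by (simp add: image_finite_def)
  with modal_le_A_back[where f = Box, OF a(3) sat.simps(6) sat.simps(6) _ x2] x2(1)
  show "\<exists>x1\<in>attributes M1. (a1, x1) \<notin> Rbox M1 \<and> (x1, x2) \<in> T"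
    by (auto simp: T_def)
next
  fix x1 x2 a1
  assume a1: "a1 \<in> objects M1" "(x1, a1) \<notin> Rdia M1" and "(x1, x2) \<in> T"
  then have x: "x1 \<in> attributes M1" "x2 \<in> attributes M2" "modal_le_X M2 x2 M1 x1"
    by (auto simp: T_def)
  have "finite {a \<in> objects M2. (x2, a) \<notin> Rdia M2}"
    using fin(2) x(2) by (simp add: image_finite_def)
  with modal_le_X_forth[where f = Dia, OF x(3) cosat.simps(7) cosat.simps(7) _ a1] a1(1)
  show "\<exists>a2\<in>objects M2. (x2, a2) \<notin> Rdia M2 \<and> (a1, a2) \<in> S"
    by (auto simp: S_def)
qed

section \<open>The Hennessy--Milner theorem\<close>

theorem theorem3p9:
  fixes M1 :: "('a1, 'x1, 'v::countable) le_model"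
    and M2 :: "('a2, 'x2, 'v) le_model"
  assumes "is_le_model M1" and "is_le_model M2"
    and "image_finite M1" and "image_finite M2"
    and "a1 \<in> objects M1" and "x1 \<in> attributes M1"
    and "a2 \<in> objects M2" and "x2 \<in> attributes M2"
  shows "(modal_le_A M1 a1 M2 a2 \<longleftrightarrow> simulated_A M1 a1 M2 a2) \<and>
         (modal_le_X M1 x1 M2 x2 \<longleftrightarrow> simulated_X M1 x1 M2 x2)"
proof (intro conjI iffI)
  assume "modal_le_A M1 a1 M2 a2"
  then show "simulated_A M1 a1 M2 a2"
    using modal_comparison_simulation[OF assms(1-4)] assms(5,7)
    unfolding simulated_A_def by blast
next
  assume "simulated_A M1 a1 M2 a2"
  then show "modal_le_A M1 a1 M2 a2"
    using simulation_preserves[OF assms(1,2)] unfolding simulated_A_def modal_le_A_def by blast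
next
  assume "modal_le_X M1 x1 M2 x2"
  then show "simulated_X M1 x1 M2 x2"
    using modal_comparison_simulation[OF assms(2,1,4,3)] assms(6,8)
    unfolding simulated_X_def by blast
next
  assume "simulated_X M1 x1 M2 x2"
  then show "modal_le_X M1 x1 M2 x2"
    using simulation_preserves[OF assms(2,1)] unfolding simulated_X_def modal_le_X_def by blast
qed

end
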